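(* Let $n,k$ be integers with $1\le k\le n-2$, let $I=[a,b]$ with $a<b$, and let $a_j\in C^{n-j}(I)$ be real-valued for $j=1,\dots,n$. For $M\in\mathbb{R}$ let $$T_n[M]\,u(t)=u^{(n)}(t)+a_1(t)\,u^{(n-1)}(t)+\cdots+a_{n-1}(t)\,u'(t)+(a_n(t)+M)\,u(t),\quad t\in I.$$ Then the following two properties hold. (1) If $n-k$ is even, then there is no $M\in\mathbb{R}$ such that $T_n[M]$ is inverse negative on $X_k$. (2) If $n-k$ is odd, then there is no $M\in\mathbb{R}$ such that $T_n[M]$ is inverse positive on $X_k$.
   Context: $X_k=\{u\in C^n(I) : u(a)=u'(a)=\cdots=u^{(k-1)}(a)=0,\ u(b)=u'(b)=\cdots=u^{(n-k-1)}(b)=0\}$. $T_n[M]$ is inverse positive (respectively inverse negative) on $X_k$ if every $u\in X_k$ with $T_n[M]\,u\ge0$ on $I$ satisfies $u\ge0$ (respectively $u\le0$) on $I$. *)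

theory Defs
  imports "HOL-Analysis.Analysis"
begin

(* Derivatives are taken within S, hence one-sided at the end points of S = {a..b}:
   they only depend on the restriction of f to S. *)
primrec nderiv_within :: "real set \<Rightarrow> nat \<Rightarrow> (real \<Rightarrow> real) \<Rightarrow> real \<Rightarrow> real" where
  "nderiv_within S 0 f = f"
| "nderiv_within S (Suc j) f = (\<lambda>t. vector_derivative (nderiv_within S j f) (at t within S))"

(* Functions in C^m(S) are represented by total functions; values outside S are irrelevant. *)
definition Cn_on :: "nat \<Rightarrow> real set \<Rightarrow> (real \<Rightarrow> real) set" where
  "Cn_on m S = {f. (\<forall>j<m. nderiv_within S j f differentiable_on S)
                   \<and> continuous_on S (nderiv_within S m f)}"

(* c j is the coefficient a_j of the derivative of order n - j (1 <= j <= n); the zero-order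
   coefficient is c n + M. *)
definition linear_op ::
    "real \<Rightarrow> real \<Rightarrow> nat \<Rightarrow> (nat \<Rightarrow> real \<Rightarrow> real) \<Rightarrow> real \<Rightarrow> (real \<Rightarrow> real) \<Rightarrow> real \<Rightarrow> real" where
  "linear_op a b n c M u t =
     nderiv_within {a..b} n u t
     + (\<Sum>j = 1..n - 1. c j t * nderiv_within {a..b} (n - j) u t)
     + (c n t + M) * u t"

definition X_space :: "real \<Rightarrow> real \<Rightarrow> nat \<Rightarrow> nat \<Rightarrow> (real \<Rightarrow> real) set" where
  "X_space a b n k = {u \<in> Cn_on n {a..b}.
     (\<forall>j<k. nderiv_within {a..b} j u a = 0) \<and> (\<forall>j<n - k. nderiv_within {a..b} j u b = 0)}"

definition inverse_positive_on ::
    "real set \<Rightarrow> ((real \<Rightarrow> real) \<Rightarrow> real \<Rightarrow> real) \<Rightarrow> (real \<Rightarrow> real) set \<Rightarrow> bool" where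
  "inverse_positive_on S L X \<longleftrightarrow>
     (\<forall>u\<in>X. (\<forall>t\<in>S. L u t \<ge> 0) \<longrightarrow> (\<forall>t\<in>S. u t \<ge> 0))"

definition inverse_negative_on ::
    "real set \<Rightarrow> ((real \<Rightarrow> real) \<Rightarrow> real \<Rightarrow> real) \<Rightarrow> (real \<Rightarrow> real) set \<Rightarrow> bool" where
  "inverse_negative_on S L X \<longleftrightarrow>
     (\<forall>u\<in>X. (\<forall>t\<in>S. L u t \<ge> 0) \<longrightarrow> (\<forall>t\<in>S. u t \<le> 0))"

end

theory Submission
  imports Defs
begin

text \<open>
  Suppose the sign property holds for some \<open>M\<close> and let \<open>\<sigma> = (-1)^(n-k)\<close>. It makes \<open>T = T_n[M]\<close>
  injective on \<open>X_k\<close>, so by linear algebra on the fundamental system of \<open>T w = 0\<close> there are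
  solutions \<open>w_i\<close> (\<open>i < k\<close>) satisfying the conditions of \<open>X_k\<close> at \<open>b\<close> and having
  \<open>w_i^(j)(a) = \<delta>_ij\<close> for \<open>j < k\<close>. For small \<open>e > 0\<close> the explicit function
  \<open>P(t) = (-1)^n max(0, a + e - t)^(n+1)\<close> has \<open>T P \<ge> 0\<close>, because its \<open>n\<close>-th derivative
  dominates the lower ones. Hence \<open>u = P - (\<Sum>i<k. P^(i)(a) w_i)\<close> lies in \<open>X_k\<close> and
  \<open>T u = T P \<ge> 0\<close>. At a fixed point \<open>t > a + e\<close> only the \<open>w_i\<close> contribute, and since \<open>P^(i)(a)\<close> is of
  order \<open>e^(n+1-i)\<close>, the term \<open>i = k - 1\<close> dominates as \<open>e \<rightarrow> 0\<close>. Its sign is that of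
  \<open>\<sigma> w_{k-1}(t)\<close>, and \<open>w_{k-1} > 0\<close> to the right of \<open>a\<close>, so \<open>\<sigma> u(t) > 0\<close>:
  the forbidden sign.
\<close>

section \<open>Linear systems: nontrivial kernels and solvability\<close>

text \<open>One step of Gaussian elimination per equation: a pivot \<open>p\<close> in the last
  equation removes one unknown and one equation. The index set is arbitrary because the pivot may be
  any of its elements.\<close>

lemma underdetermined_system:
  fixes A :: "nat \<Rightarrow> 'a \<Rightarrow> real"
  assumes "finite J" and "m < card J"
  shows "\<exists>x. (\<exists>j\<in>J. x j \<noteq> 0) \<and> (\<forall>i<m. (\<Sum>j\<in>J. A i j * x j) = 0)"
  using assms
proof (induction m arbitrary: A J)
  case 0
  then obtain j where "j \<in> J" by fastforce
  then show ?case by (intro exI[of _ "\<lambda>_. 1"]) auto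
next
  case (Suc m)
  show ?case
  proof (cases "\<forall>j\<in>J. A m j = 0")
    case True
    obtain x where x: "\<exists>j\<in>J. x j \<noteq> 0" "\<forall>i<m. (\<Sum>j\<in>J. A i j * x j) = 0"
      using Suc.IH[OF Suc.prems(1), of A] Suc.prems(2) by auto
    then show ?thesis
      using True by (intro exI[of _ x]) (auto simp: less_Suc_eq)
  next
    case False
    then obtain p where p: "p \<in> J" "A m p \<noteq> 0" by auto
    define J' where "J' = J - {p}"
    have J': "finite J'" "m < card J'" "p \<notin> J'" "J = insert p J'"
      using Suc.prems p by (auto simp: J'_def)
    obtain x where x: "\<exists>j\<in>J'. x j \<noteq> 0"
      "\<forall>i<m. (\<Sum>j\<in>J'. (A i j - A i p * A m j / A m p) * x j) = 0"
      using Suc.IH[OF J'(1,2), of "\<lambda>i j. A i j - A i p * A m j / A m p"] by auto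
    \<comment> \<open>The entry at \<open>p\<close> is the one that satisfies equation
      \<open>m\<close>; the reduced coefficients were chosen so that the other equations then hold
      as well.\<close>
    define y where "y = x(p := - (\<Sum>j\<in>J'. A m j * x j) / A m p)"
    have split: "(\<Sum>j\<in>J. A i j * y j) = A i p * y p + (\<Sum>j\<in>J'. A i j * x j)" for i
    proof -
      have "(\<Sum>j\<in>J'. A i j * y j) = (\<Sum>j\<in>J'. A i j * x j)"
        using J'(3) by (intro sum.cong) (auto simp: y_def)
      then show ?thesis using J' by simp
    qed
    have "(\<Sum>j\<in>J. A i j * y j) = 0" if "i < Suc m" for i
    proof (cases "i = m")
      case True
      then show ?thesis using p unfolding split by (simp add: y_def)
    next
      case False
      then have "(\<Sum>j\<in>J'. (A i j - A i p * A m j / A m p) * x j) = 0"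
        using x(2) that by simp
      then have "(\<Sum>j\<in>J'. A i j * x j) = (\<Sum>j\<in>J'. A i p / A m p * (A m j * x j))"
        by (simp add: left_diff_distrib sum_subtractf mult.assoc)
      then show ?thesis unfolding split sum_distrib_left[symmetric] using p by (simp add: y_def)
    qed
    moreover have "\<exists>j\<in>J. y j \<noteq> 0" using x(1) J' by (auto simp: y_def)
    ultimately show ?thesis by blast
  qed
qed

text \<open>Append \<open>v\<close> as an extra column. The enlarged system has a nonzero kernel
  vector, injectivity forces its last entry to be nonzero, and division by minus that entry gives a
  solution.\<close>

lemma square_system_solvable:
  fixes A :: "nat \<Rightarrow> nat \<Rightarrow> real"
  assumes inj: "\<And>x. \<forall>i<m. (\<Sum>j<m. A i j * x j) = 0 \<Longrightarrow> \<forall>j<m. x j = 0"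
  shows "\<exists>x. \<forall>i<m. (\<Sum>j<m. A i j * x j) = v i"
proof -
  define B where "B i j = (if j < m then A i j else v i)" for i j
  obtain x where x: "\<exists>j\<in>{..<Suc m}. x j \<noteq> 0" "\<forall>i<m. (\<Sum>j<Suc m. B i j * x j) = 0"
    using underdetermined_system[of "{..<Suc m}" m B] by auto
  have eq: "(\<Sum>j<m. A i j * x j) + v i * x m = 0" if "i < m" for i
  proof -
    have "(\<Sum>j<m. A i j * x j) = (\<Sum>j<m. B i j * x j)"
      by (intro sum.cong) (auto simp: B_def)
    then show ?thesis using x(2) that by (simp add: B_def)
  qed
  have nz: "x m \<noteq> 0"
  proof
    assume "x m = 0"
    then have "\<forall>j<m. x j = 0" using inj[of x] eq \<open>x m = 0\<close> by simp
    then show False using x(1) \<open>x m = 0\<close> by (auto simp: less_Suc_eq)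
  qed
  have "(\<Sum>j<m. A i j * (- x j / x m)) = v i" if "i < m" for i
  proof -
    have "(\<Sum>j<m. A i j * (- x j / x m)) = - (\<Sum>j<m. A i j * x j) / x m"
      by (simp add: sum_divide_distrib sum_negf)
    also have "\<dots> = v i" using eq[OF that] nz by (simp add: field_simps)
    finally show ?thesis .
  qed
  then show ?thesis by (intro exI[of _ "\<lambda>j. - x j / x m"]) simp
qed

section \<open>Functions carried along with their derivatives\<close>

text \<open>\<open>F j\<close> plays the role of the \<open>j\<close>-th derivative of \<open>F 0\<close>.\<close>

definition derivative_chain :: "real set \<Rightarrow> nat \<Rightarrow> (nat \<Rightarrow> real \<Rightarrow> real) \<Rightarrow> bool" where
  "derivative_chain S m F \<longleftrightarrow>
     (\<forall>j<m. \<forall>t\<in>S. (F j has_vector_derivative F (Suc j) t) (at t within S))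
     \<and> continuous_on S (F m)"

lemma derivative_chain_continuous:
  assumes "derivative_chain S m F" "j \<le> m"
  shows "continuous_on S (F j)"
proof (cases "j = m")
  case False
  then have "\<forall>t\<in>S. (F j has_vector_derivative F (Suc j) t) (at t within S)"
    using assms by (auto simp: derivative_chain_def)
  then show ?thesis
    by (meson continuous_on_eq_continuous_within has_vector_derivative_continuous)
qed (use assms in \<open>auto simp: derivative_chain_def\<close>)

text \<open>Since \<open>a < b\<close>, derivatives within the interval are unique. Agreement of
  \<open>u\<close> with \<open>F 0\<close> on the interval alone is enough, so a function vanishing
  there can later be compared with the zero chain.\<close>

lemma nderiv_within_chain:
  assumes "a < b" and F: "derivative_chain {a..b} m F" and u: "\<And>t. t \<in> {a..b} \<Longrightarrow> u t = F 0 t"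
    and "j \<le> m" "t \<in> {a..b}"
  shows "nderiv_within {a..b} j u t = F j t"
  using assms(4,5)
proof (induction j arbitrary: t)
  case 0
  then show ?case using u by simp
next
  case (Suc j)
  have "(F j has_vector_derivative F (Suc j) t) (at t within {a..b})"
    using F Suc.prems by (auto simp: derivative_chain_def)
  then have "(nderiv_within {a..b} j u has_vector_derivative F (Suc j) t) (at t within {a..b})"
    by (rule has_vector_derivative_transform[OF Suc.prems(2), rotated])
      (rule Suc.IH, use Suc.prems in simp_all)
  then show ?case
    using vector_derivative_within_closed_interval[OF \<open>a < b\<close> Suc.prems(2)] by simp
qed

lemma derivative_chain_Cn_on:
  assumes "a < b" and F: "derivative_chain {a..b} m F"
  shows "F 0 \<in> Cn_on m {a..b}"
proof -
  have eq: "nderiv_within {a..b} j (F 0) t = F j t" if "j \<le> m" "t \<in> {a..b}" for j t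
    by (rule nderiv_within_chain[OF assms refl that])
  have "nderiv_within {a..b} j (F 0) differentiable_on {a..b}" if "j < m" for j
    unfolding differentiable_on_def
  proof
    fix t assume t: "t \<in> {a..b}"
    have "(F j has_vector_derivative F (Suc j) t) (at t within {a..b})"
      using F that t by (auto simp: derivative_chain_def)
    then have "(nderiv_within {a..b} j (F 0) has_vector_derivative F (Suc j) t) (at t within {a..b})"
      by (rule has_vector_derivative_transform[OF t, rotated]) (rule eq, use that in simp_all)
    then show "nderiv_within {a..b} j (F 0) differentiable at t within {a..b}"
      by (rule differentiableI_vector)
  qed
  moreover have "continuous_on {a..b} (nderiv_within {a..b} m (F 0))"
    using derivative_chain_continuous[OF F order_refl]
    by (subst continuous_on_cong[OF refl, of _ _ "F m"]) (simp_all add: eq)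
  ultimately show ?thesis by (simp add: Cn_on_def)
qed

lemma derivative_chain_sum:
  assumes "\<And>i. i \<in> A \<Longrightarrow> derivative_chain S m (F i)"
  shows "derivative_chain S m (\<lambda>j t. \<Sum>i\<in>A. x i * F i j t)"
  using assms unfolding derivative_chain_def
  by (auto intro!: has_vector_derivative_sum has_vector_derivative_mult_right continuous_intros)

lemma derivative_chain_add:
  assumes "derivative_chain S m F" "derivative_chain S m G"
  shows "derivative_chain S m (\<lambda>j t. F j t + G j t)"
  using assms unfolding derivative_chain_def
  by (auto intro!: has_vector_derivative_add continuous_intros)

text \<open>Here \<open>d n\<close> is the whole zero-order coefficient, including the shift by M,
  so that all coefficients can be treated alike.\<close>

definition chain_op :: "nat \<Rightarrow> (nat \<Rightarrow> real \<Rightarrow> real) \<Rightarrow> (nat \<Rightarrow> real \<Rightarrow> real) \<Rightarrow> real \<Rightarrow> real" where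
  "chain_op n d F t = F n t + (\<Sum>j = 1..n. d j t * F (n - j) t)"

lemma chain_op_sum:
  "chain_op n d (\<lambda>j t. \<Sum>i\<in>A. x i * F i j t) t = (\<Sum>i\<in>A. x i * chain_op n d (F i) t)"
proof -
  have "(\<Sum>j = 1..n. d j t * (\<Sum>i\<in>A. x i * F i (n - j) t))
      = (\<Sum>i\<in>A. x i * (\<Sum>j = 1..n. d j t * F i (n - j) t))"
    unfolding sum_distrib_left by (subst sum.swap) (simp add: mult.left_commute)
  then show ?thesis by (simp add: chain_op_def sum.distrib distrib_left)
qed

lemma chain_op_add:
  "chain_op n d (\<lambda>j t. F j t + G j t) t = chain_op n d F t + chain_op n d G t"
  by (simp add: chain_op_def sum.distrib distrib_left)

section \<open>Initial value problems via a Volterra equation\<close>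

text \<open>With \<open>y\<close> as the derivative of order n, this is the derivative of order n -
  m of the function to be reconstructed; \<open>v m\<close> is its prescribed value at
  \<open>a\<close>.\<close>

primrec iterated_integral :: "real \<Rightarrow> (nat \<Rightarrow> real) \<Rightarrow> nat \<Rightarrow> (real \<Rightarrow> real) \<Rightarrow> real \<Rightarrow> real" where
  "iterated_integral a v 0 y = y"
| "iterated_integral a v (Suc m) y = (\<lambda>t. v (Suc m) + integral {a..t} (iterated_integral a v m y))"

lemma iterated_integral_continuous:
  assumes "continuous_on {a..b} y"
  shows "continuous_on {a..b} (iterated_integral a v m y)"
  by (induction m) (auto intro!: continuous_intros indefinite_integral_continuous_1
      integrable_continuous_real simp: assms)

text \<open>The weight \<open>exp (L * (t - a))\<close> makes the Volterra operator below a contraction for large \<open>L\<close>.\<close>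

lemma iterated_integral_diff_bound:
  assumes y: "continuous_on {a..b} y" "continuous_on {a..b} z"
    and bound: "\<And>s. s \<in> {a..b} \<Longrightarrow> \<bar>y s - z s\<bar> \<le> K * exp (L * (s - a))"
    and L: "L > 0" and t: "t \<in> {a..b}"
  shows "\<bar>iterated_integral a v m y t - iterated_integral a v m z t\<bar> \<le> K / L ^ m * exp (L * (t - a))"
  using t
proof (induction m arbitrary: t)
  case 0
  then show ?case using bound by simp
next
  case (Suc m)
  let ?I = "iterated_integral a v m"
  have sub: "{a..t} \<subseteq> {a..b}" using Suc.prems by auto
  have int: "?I y integrable_on {a..t}" "?I z integrable_on {a..t}"
    using y by (auto intro!: integrable_continuous_real
        continuous_on_subset[OF iterated_integral_continuous sub])
  have K: "K \<ge> 0" using bound[of t] Suc.prems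
    by (smt (verit) exp_gt_zero mult_neg_pos)
  \<comment> \<open>Integrating the exponential weight gains a factor 1 / L, which is how the bound
    passes from \<open>L ^ m\<close> to \<open>L ^ Suc m\<close>.\<close>
  have ex: "((\<lambda>s. K / L ^ m * exp (L * (s - a))) has_integral
      (K / L ^ Suc m * exp (L * (t - a)) - K / L ^ Suc m * exp (L * (a - a)))) {a..t}"
    using Suc.prems L
    by (intro fundamental_theorem_of_calculus)
      (auto intro!: derivative_eq_intros simp: has_real_derivative_iff_has_vector_derivative[symmetric])
  have "\<bar>integral {a..t} (\<lambda>s. ?I y s - ?I z s)\<bar> \<le> integral {a..t} (\<lambda>s. K / L ^ m * exp (L * (s - a)))"
    unfolding real_norm_def[symmetric]
    using Suc.IH sub int ex
    by (intro integral_norm_bound_integral integrable_diff) (auto simp: has_integral_integrable)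
  also have "\<dots> \<le> K / L ^ Suc m * exp (L * (t - a))"
    using integral_unique[OF ex] K L by simp
  finally show ?case using int by (simp add: integral_diff)
qed

lemma iterated_integral_chain:
  assumes "a \<le> b" "continuous_on {a..b} y"
  shows "derivative_chain {a..b} n (\<lambda>j. iterated_integral a v (n - j) y)"
  unfolding derivative_chain_def
proof (intro conjI allI impI ballI)
  fix j t assume j: "j < n" and t: "t \<in> {a..b}"
  then obtain m where m: "n - j = Suc m" "n - Suc j = m" by (cases "n - j") auto
  have "((\<lambda>t. integral {a..t} (iterated_integral a v m y)) has_vector_derivative
      iterated_integral a v m y t) (at t within {a..b})"
    by (rule integral_has_vector_derivative[OF iterated_integral_continuous[OF assms(2)] t])
  then have "((\<lambda>t. v (Suc m) + integral {a..t} (iterated_integral a v m y)) has_vector_derivative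
      0 + iterated_integral a v m y t) (at t within {a..b})"
    by (intro has_vector_derivative_add has_vector_derivative_const)
  then show "(iterated_integral a v (n - j) y has_vector_derivative
      iterated_integral a v (n - Suc j) y t) (at t within {a..b})"
    by (simp add: m)
next
  show "continuous_on {a..b} (iterated_integral a v (n - n) y)" using assms by simp
qed

lemma clamp_real_in: "a \<le> b \<Longrightarrow> clamp a b s \<in> {a..b}" for a b s :: real
  using clamp_in_interval[of a b s] by simp

text \<open>Banach's fixed point theorem in an exponentially weighted sup norm, which yields a
  solution on the whole interval at once.\<close>

lemma volterra_solution_exists:
  assumes "a \<le> b" and d: "\<And>j. j \<in> {1..n} \<Longrightarrow> continuous_on {a..b} (d j)"
  shows "\<exists>y. continuous_on {a..b} y \<and>
    (\<forall>t\<in>{a..b}. y t + (\<Sum>j = 1..n. d j t * iterated_integral a v j y t) = 0)"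
proof -
  have "\<exists>D. \<forall>t\<in>{a..b}. \<bar>d j t\<bar> \<le> D" if "j \<in> {1..n}" for j
    using compact_imp_bounded[OF compact_continuous_image[OF d[OF that] compact_Icc]]
    by (auto simp: bounded_iff)
  then obtain D0 where D0: "\<And>j t. j \<in> {1..n} \<Longrightarrow> t \<in> {a..b} \<Longrightarrow> \<bar>d j t\<bar> \<le> D0 j" by metis
  define D where "D = (\<Sum>j=1..n. \<bar>D0 j\<bar>)"
  have D: "\<bar>d j t\<bar> \<le> \<bar>D0 j\<bar>" if "j \<in> {1..n}" "t \<in> {a..b}" for j t
    using D0[OF that] by simp
  have Dpos: "D \<ge> 0" by (auto simp: D_def intro: sum_nonneg)
  \<comment> \<open>This gives D / L \<le> 1/2, the contraction constant, and L \<ge> 1, so that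
    \<open>L ^ j\<close> is at least \<open>L\<close> for all j \<ge> 1.\<close>
  define L where "L = 2 * D + 1"
  have L: "L \<ge> 1" "L > 0" using Dpos by (auto simp: L_def)
  \<comment> \<open>The unknown is y = \<open>Y z\<close>; the plain sup norm of \<open>z\<close> is
    the weighted norm of y.\<close>
  define Y where "Y z s = exp (L * (s - a)) * apply_bcontfun z s" for z :: "real \<Rightarrow>\<^sub>C real" and s
  have Y: "continuous_on {a..b} (Y z)" for z
    unfolding Y_def by (intro continuous_intros) auto
  define G where "G z s = - exp (- (L * (s - a))) * (\<Sum>j=1..n. d j s * iterated_integral a v j (Y z) s)" for z s
  have G: "continuous_on {a..b} (G z)" for z
    unfolding G_def by (intro continuous_intros iterated_integral_continuous Y d)
  \<comment> \<open>Elements of the complete space are bounded continuous functions on the whole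
    line; \<open>clamp\<close> extends \<open>G z\<close> from the interval by constants.\<close>
  define \<Phi> where "\<Phi> z = Bcontfun (\<lambda>s. G z (clamp a b s))" for z
  have \<Phi>: "apply_bcontfun (\<Phi> z) s = G z (clamp a b s)" for z s
  proof -
    have "bounded (range (\<lambda>s. G z (clamp a b s)))"
      by (rule bounded_subset[OF compact_imp_bounded[OF compact_continuous_image[OF G compact_Icc]]])
        (use clamp_real_in[OF assms(1)] in blast)
    moreover have "continuous_on UNIV (\<lambda>s. G z (clamp a b s))"
      by (rule clamp_continuous_on) (use G in simp)
    ultimately show ?thesis
      unfolding \<Phi>_def by (subst Bcontfun_inverse) (auto simp: bcontfun_def)
  qed
  have "dist (\<Phi> z) (\<Phi> w) \<le> 1 / 2 * dist z w" for z w
  proof (rule dist_bound)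
    fix s0 :: real
    define s where "s = clamp a b s0"
    have s: "s \<in> {a..b}" using clamp_real_in[OF assms(1)] by (simp add: s_def)
    define K where "K = dist z w"
    have YK: "\<bar>Y z r - Y w r\<bar> \<le> K * exp (L * (r - a))" for r
      using dist_bounded[of z r w]
      by (simp add: Y_def K_def dist_real_def abs_mult flip: right_diff_distrib)
    have summand: "\<bar>d j s * iterated_integral a v j (Y z) s - d j s * iterated_integral a v j (Y w) s\<bar>
        \<le> \<bar>D0 j\<bar> * (K / L * exp (L * (s - a)))" if j: "j \<in> {1..n}" for j
    proof -
      have "\<bar>iterated_integral a v j (Y z) s - iterated_integral a v j (Y w) s\<bar>
          \<le> K / L ^ j * exp (L * (s - a))"
        by (rule iterated_integral_diff_bound[OF Y Y YK L(2) s])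
      also have "\<dots> \<le> K / L * exp (L * (s - a))"
        using L j power_increasing[of 1 j L]
        by (intro mult_right_mono divide_left_mono) (auto simp: K_def)
      finally show ?thesis
        unfolding right_diff_distrib[symmetric] abs_mult
        by (intro mult_mono D[OF j s]) auto
    qed
    have "\<bar>(\<Sum>j=1..n. d j s * iterated_integral a v j (Y z) s) - (\<Sum>j=1..n. d j s * iterated_integral a v j (Y w) s)\<bar>
        \<le> (\<Sum>j=1..n. \<bar>D0 j\<bar> * (K / L * exp (L * (s - a))))"
      unfolding sum_subtractf[symmetric] by (rule order_trans[OF sum_abs sum_mono[OF summand]])
    also have "\<dots> = D / L * K * exp (L * (s - a))"
      unfolding sum_distrib_right[symmetric] D_def by simp
    also have "\<dots> \<le> 1 / 2 * K * exp (L * (s - a))"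
    proof (intro mult_right_mono)
      show "D / L \<le> 1 / 2" using L by (simp add: L_def divide_le_eq)
    qed (auto simp: K_def)
    finally have *: "\<bar>(\<Sum>j=1..n. d j s * iterated_integral a v j (Y z) s) - (\<Sum>j=1..n. d j s * iterated_integral a v j (Y w) s)\<bar>
        \<le> 1 / 2 * K * exp (L * (s - a))" .
    have "\<bar>G z s - G w s\<bar> = exp (- (L * (s - a))) * \<bar>(\<Sum>j=1..n. d j s * iterated_integral a v j (Y z) s) - (\<Sum>j=1..n. d j s * iterated_integral a v j (Y w) s)\<bar>"
      unfolding G_def by (simp add: abs_mult abs_minus_commute flip: right_diff_distrib)
    also have "\<dots> \<le> exp (- (L * (s - a))) * (1 / 2 * K * exp (L * (s - a)))"
      using * by (intro mult_left_mono) auto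
    also have "\<dots> = 1 / 2 * K * (exp (- (L * (s - a))) * exp (L * (s - a)))" by (simp only: mult_ac)
    also have "\<dots> = 1 / 2 * K" unfolding mult_exp_exp by simp
    finally show "dist (apply_bcontfun (\<Phi> z) s0) (apply_bcontfun (\<Phi> w) s0) \<le> 1 / 2 * dist z w"
      by (simp add: \<Phi> dist_real_def K_def s_def)
  qed
  then have contraction: "\<forall>z w. dist (\<Phi> z) (\<Phi> w) \<le> 1 / 2 * dist z w" by blast
  obtain z where z: "\<Phi> z = z"
    using banach_fix_type[OF _ _ contraction] by auto
  have "Y z t + (\<Sum>j=1..n. d j t * iterated_integral a v j (Y z) t) = 0" if t: "t \<in> {a..b}" for t
  proof -
    have "apply_bcontfun z t = G z t"
      using \<Phi>[of z t, unfolded z] t clamp_cancel_cbox[of t a b] by simp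
    then have "Y z t = exp (L * (t - a)) * G z t" by (simp add: Y_def)
    also have "\<dots> = - (exp (L * (t - a)) * exp (- (L * (t - a)))) * (\<Sum>j=1..n. d j t * iterated_integral a v j (Y z) t)"
      by (simp add: G_def)
    also have "exp (L * (t - a)) * exp (- (L * (t - a))) = 1" unfolding mult_exp_exp by simp
    finally show ?thesis by simp
  qed
  then show ?thesis using Y by blast
qed

text \<open>The Volterra solution serves as the derivative of order n, its iterated integrals as the
  lower ones. The indices in \<open>?v\<close> are reversed because \<open>iterated_integral\<close>
  counts integrations whereas \<open>v\<close> counts derivatives.\<close>

lemma linear_ode_solution_exists:
  assumes "a \<le> b" and d: "\<And>j. j \<in> {1..n} \<Longrightarrow> continuous_on {a..b} (d j)"
  shows "\<exists>F. derivative_chain {a..b} n F \<and> (\<forall>t\<in>{a..b}. chain_op n d F t = 0) \<and> (\<forall>j<n. F j a = v j)"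
proof -
  let ?v = "\<lambda>m. v (n - m)"
  obtain y where y: "continuous_on {a..b} y"
    "\<forall>t\<in>{a..b}. y t + (\<Sum>j = 1..n. d j t * iterated_integral a ?v j y t) = 0"
    using volterra_solution_exists[of a b n d ?v, OF assms(1) d] by blast
  let ?F = "\<lambda>j. iterated_integral a ?v (n - j) y"
  have "chain_op n d ?F t = 0" if "t \<in> {a..b}" for t
    using y(2) that by (simp add: chain_op_def)
  moreover have "?F j a = v j" if j: "j < n" for j
  proof -
    obtain m where m: "n - j = Suc m" "n - Suc m = j" using j by (cases "n - j") auto
    then show ?thesis by simp
  qed
  ultimately show ?thesis using iterated_integral_chain[OF assms(1) y(1)] by blast
qed

section \<open>Sign to the right of a multiple zero\<close>

text \<open>Positivity descends from each derivative to the one below it, which starts from 0 at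
  \<open>a\<close> and is strictly increasing.\<close>

lemma derivative_chain_pos:
  assumes "derivative_chain {a..b} m F" "c \<le> b" "\<And>j. j < m \<Longrightarrow> F j a = 0"
    and "\<And>t. a < t \<Longrightarrow> t \<le> c \<Longrightarrow> F m t > 0"
    and "a < t" "t \<le> c"
  shows "F 0 t > 0"
  using assms
proof (induction m arbitrary: F t)
  case (Suc m)
  have F: "(F 0 has_vector_derivative F (Suc 0) s) (at s within {a..b})" if "s \<in> {a..b}" for s
    using Suc.prems(1) that by (auto simp: derivative_chain_def)
  have "derivative_chain {a..b} m (\<lambda>j. F (Suc j))"
    using Suc.prems(1) by (auto simp: derivative_chain_def)
  then have pos: "F (Suc 0) s > 0" if "a < s" "s \<le> c" for s
    using Suc.IH[of "\<lambda>j. F (Suc j)" s] Suc.prems that by simp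
  have "F 0 a < F 0 t"
  proof (rule DERIV_pos_imp_increasing_open[OF Suc.prems(5)])
    fix s assume s: "a < s" "s < t"
    then have "(F 0 has_vector_derivative F (Suc 0) s) (at s)"
      using F[of s] Suc.prems at_within_Icc_at[of a s b] by simp
    then show "\<exists>y. (F 0 has_real_derivative y) (at s) \<and> 0 < y"
      using pos[of s] s Suc.prems by (auto simp: has_real_derivative_iff_has_vector_derivative)
  next
    show "continuous_on {a..t} (F 0)"
      by (rule continuous_on_subset[OF derivative_chain_continuous[OF Suc.prems(1)]])
        (use Suc.prems in auto)
  qed
  then show ?case using Suc.prems(3)[of 0] by simp
qed simp

section \<open>Truncated powers and the operator applied to them\<close>

text \<open>Only x = 0 is delicate: there the difference quotient is at most \<bar>h\<bar>^m in
  absolute value, which tends to 0 because m > 0.\<close>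

lemma has_real_derivative_max_0_power:
  assumes "m > 0"
  shows "((\<lambda>x::real. max 0 x ^ Suc m) has_real_derivative real (Suc m) * max 0 x ^ m) (at x)"
proof -
  consider "x < 0" | "x = 0" | "x > 0" by linarith
  then show ?thesis
  proof cases
    case 1
    have "((\<lambda>x::real. 0) has_real_derivative 0) (at x)" by simp
    then have "((\<lambda>x::real. max 0 x ^ Suc m) has_real_derivative 0) (at x)"
      by (rule has_field_derivative_transform_within_open[of _ _ _ "{..<0}"]) (use 1 in auto)
    then show ?thesis using 1 assms by (simp add: power_0_left del: power_Suc)
  next
    case 2
    have "((\<lambda>h::real. max 0 h ^ Suc m / h) \<longlongrightarrow> 0) (at 0)"
    proof (rule Lim_null_comparison)
      have "norm (max 0 h ^ Suc m / h) \<le> \<bar>h\<bar> ^ m" for h :: real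
        by (cases "h \<le> 0") (auto simp: power_abs)
      then show "\<forall>\<^sub>F h in at 0. norm (max 0 h ^ Suc m / h) \<le> \<bar>h::real\<bar> ^ m" by simp
      have "((\<lambda>h::real. \<bar>h\<bar> ^ m) \<longlongrightarrow> \<bar>0\<bar> ^ m) (at 0)" by (intro tendsto_intros)
      then show "((\<lambda>h::real. \<bar>h\<bar> ^ m) \<longlongrightarrow> 0) (at 0)"
        unfolding abs_zero zero_power[OF assms] .
    qed
    then show ?thesis using 2 assms by (simp add: DERIV_def power_0_left)
  next
    case 3
    have "((\<lambda>x::real. x ^ Suc m) has_real_derivative real (Suc m) * x ^ m) (at x)"
      by (rule derivative_eq_intros refl)+ simp
    then have "((\<lambda>x::real. max 0 x ^ Suc m) has_real_derivative real (Suc m) * x ^ m) (at x)"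
      by (rule has_field_derivative_transform_within_open[of _ _ _ "{0<..}"]) (use 3 in auto)
    then show ?thesis using 3 by simp
  qed
qed

text \<open>The \<open>j\<close>-th derivative of \<open>(-1)^n max(0, r - t)^(n+1)\<close>.\<close>

definition cutoff_chain :: "nat \<Rightarrow> real \<Rightarrow> nat \<Rightarrow> real \<Rightarrow> real" where
  "cutoff_chain n r j t = (-1) ^ (n + j) * (fact (n + 1) / fact (n + 1 - j)) * max 0 (r - t) ^ (n + 1 - j)"

text \<open>For j < n the exponent n + 1 - j is at least 2, so the kink does no harm; the derivative
  of order n is still continuous. This is why the power n + 1 is taken.\<close>

lemma cutoff_chain: "derivative_chain S n (cutoff_chain n r)"
  unfolding derivative_chain_def
proof (intro conjI allI impI ballI)
  fix j t assume j: "j < n"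
  then obtain m where m: "n - j = m" "n + 1 - j = Suc m" "n + 1 - Suc j = m" "m > 0" by auto
  have "((\<lambda>t. max 0 (r - t) ^ Suc m) has_real_derivative (real (Suc m) * max 0 (r - t) ^ m) * (-1)) (at t within S)"
    by (rule DERIV_chain2[where g = "\<lambda>t. r - t", OF has_real_derivative_max_0_power[OF m(4)]])
      (auto intro!: derivative_eq_intros)
  then have "((\<lambda>t. (-1) ^ (n + j) * (fact (n + 1) / fact (Suc m)) * max 0 (r - t) ^ Suc m) has_real_derivative
     (-1) ^ (n + j) * (fact (n + 1) / fact (Suc m)) * ((real (Suc m) * max 0 (r - t) ^ m) * (-1))) (at t within S)"
    by (rule DERIV_cmult)
  also have "(-1) ^ (n + j) * (fact (n + 1) / fact (Suc m)) * ((real (Suc m) * max 0 (r - t) ^ m) * (-1))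
      = cutoff_chain n r (Suc j) t"
    unfolding cutoff_chain_def m fact_Suc[of m] by (simp add: divide_simps)
  finally show "(cutoff_chain n r j has_vector_derivative cutoff_chain n r (Suc j) t) (at t within S)"
    unfolding cutoff_chain_def[abs_def] m has_real_derivative_iff_has_vector_derivative .
next
  show "continuous_on S (cutoff_chain n r n)"
    unfolding cutoff_chain_def by (intro continuous_intros)
qed

lemma cutoff_chain_eq_0: "j \<le> n \<Longrightarrow> r \<le> t \<Longrightarrow> cutoff_chain n r j t = 0"
  by (simp add: cutoff_chain_def)

text \<open>With p = max(0, a + e - t) \<le> 1, the leading term is (n+1)! p, while each of the n
  lower terms is at most D (n+1)! p^2 in absolute value. The sum is therefore at least (n+1)! p (1 -
  n D p).\<close>

lemma chain_op_cutoff_nonneg: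
  assumes D: "\<And>j t. j \<in> {1..n} \<Longrightarrow> t \<in> {a..b} \<Longrightarrow> \<bar>d j t\<bar> \<le> D"
    and e: "e \<le> 1" "real n * D * e \<le> 1" and t: "t \<in> {a..b}"
  shows "chain_op n d (cutoff_chain n (a + e)) t \<ge> 0"
proof -
  define p where "p = max 0 (a + e - t)"
  have p: "0 \<le> p" "p \<le> 1" "p = 0 \<or> p \<le> e" using e t by (auto simp: p_def)
  have summand: "- (fact (n + 1) * p) * (D * p) \<le> d j t * cutoff_chain n (a + e) (n - j) t" if j: "j \<in> {1..n}" for j
  proof -
    have [simp]: "Suc n - (n - j) = Suc j" using j by auto
    have "\<bar>cutoff_chain n (a + e) (n - j) t\<bar> = fact (n + 1) / fact (Suc j) * p ^ Suc j"
      using p by (simp add: cutoff_chain_def p_def[symmetric] abs_mult power_abs del: fact_Suc)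
    also have "\<dots> \<le> fact (n + 1) / 1 * p ^ 2"
      using p j fact_ge_1[of "Suc j", where 'a = real]
      by (intro mult_mono divide_left_mono power_decreasing) (auto simp del: fact_Suc)
    finally have "\<bar>d j t * cutoff_chain n (a + e) (n - j) t\<bar> \<le> D * (fact (n + 1) * p ^ 2)"
      using D[OF j t] unfolding abs_mult by (intro mult_mono) auto
    then show ?thesis by (simp add: power2_eq_square algebra_simps abs_le_iff)
  qed
  have "(\<Sum>j = 1..n. - (fact (n + 1) * p) * (D * p)) \<le> (\<Sum>j = 1..n. d j t * cutoff_chain n (a + e) (n - j) t)"
    by (rule sum_mono[OF summand])
  moreover have "cutoff_chain n (a + e) n t = fact (n + 1) * p"
    by (simp add: cutoff_chain_def p_def del: fact_Suc)
  ultimately have "chain_op n d (cutoff_chain n (a + e)) t \<ge> fact (n + 1) * p - real n * (fact (n + 1) * p * (D * p))"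
    by (simp add: chain_op_def)
  also have "fact (n + 1) * p - real n * (fact (n + 1) * p * (D * p)) = fact (n + 1) * p * (1 - real n * D * p)"
    by (simp add: algebra_simps)
  finally have ge: "chain_op n d (cutoff_chain n (a + e)) t \<ge> fact (n + 1) * p * (1 - real n * D * p)" .
  have "fact (n + 1) * p * (1 - real n * D * p) \<ge> 0"
  \<comment> \<open>For p nonzero, p \<le> e; for n > 0, D \<ge> 0 follows from the bound on a
    coefficient. Together they give n D p \<le> n D e \<le> 1.\<close>
  proof (cases "p = 0 \<or> n = 0")
    case False
    then have "p \<le> e" "D \<ge> 0" using p D[of n t] t by auto
    then have "real n * D * p \<le> real n * D * e" by (intro mult_left_mono) auto
    then show ?thesis using e p by (intro mult_nonneg_nonneg) auto
  qed (use p in auto)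
  then show ?thesis using ge by linarith
qed

section \<open>The contradiction, in terms of derivative chains\<close>

text \<open>The factor (-1)^(n-k) in \<open>neg\<close> treats both parities together: the premise
  is inverse negativity for n - k even and inverse positivity for n - k odd.\<close>

lemma no_sign_preservation:
  assumes "a < b" "1 \<le> k" "k \<le> n"
    and d: "\<And>j. j \<in> {1..n} \<Longrightarrow> continuous_on {a..b} (d j)"
    and neg: "\<And>F. derivative_chain {a..b} n F \<Longrightarrow> (\<And>j. j < k \<Longrightarrow> F j a = 0) \<Longrightarrow>
      (\<And>j. j < n - k \<Longrightarrow> F j b = 0) \<Longrightarrow> (\<And>t. t \<in> {a..b} \<Longrightarrow> chain_op n d F t \<ge> 0) \<Longrightarrow>
      (\<And>t. t \<in> {a..b} \<Longrightarrow> (-1) ^ (n - k) * F 0 t \<le> 0)"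
  shows False
proof -
  have "\<exists>F. derivative_chain {a..b} n F \<and> (\<forall>t\<in>{a..b}. chain_op n d F t = 0) \<and>
      (\<forall>j<n. F j a = (if i = j then 1 else 0))" for i
    using \<open>a < b\<close> d by (intro linear_ode_solution_exists) auto
  then obtain \<phi> where \<phi>: "\<And>i. derivative_chain {a..b} n (\<phi> i)"
    "\<And>i t. t \<in> {a..b} \<Longrightarrow> chain_op n d (\<phi> i) t = 0"
    "\<And>i j. j < n \<Longrightarrow> \<phi> i j a = (if i = j then 1 else 0)"
    by metis
  \<comment> \<open>These are the solutions whose derivatives of order below k vanish at
    \<open>a\<close>; the entries of \<open>x\<close> are their derivatives of orders k to n - 1
    there.\<close>
  define comb where "comb x j t = (\<Sum>l<n - k. x l * \<phi> (k + l) j t)" for x :: "nat \<Rightarrow> real" and j t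
  have comb: "derivative_chain {a..b} n (comb x)" "\<And>t. t \<in> {a..b} \<Longrightarrow> chain_op n d (comb x) t = 0" for x
    using derivative_chain_sum[where x = x and F = "\<lambda>l. \<phi> (k + l)" and A = "{..<n - k}"]
      chain_op_sum[of n d x "\<lambda>l. \<phi> (k + l)" "{..<n - k}"] \<phi>
    by (simp_all add: comb_def[abs_def])
  have comb_a: "comb x j a = 0" if "j < k" for x j
    unfolding comb_def using that \<open>k \<le> n\<close> by (intro sum.neutral) (auto simp: \<phi>)
  have comb_a': "comb x (k + j) a = x j" if "j < n - k" for x j
    using that by (simp add: comb_def \<phi> if_distrib[of "\<lambda>r. _ * r"] sum.delta' cong: if_cong)
  have solvable: "\<exists>x. \<forall>r<n - k. (\<Sum>l<n - k. \<phi> (k + l) r b * x l) = v r" for v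
  proof (rule square_system_solvable)
    fix x assume "\<forall>r<n - k. (\<Sum>l<n - k. \<phi> (k + l) r b * x l) = 0"
    then have b0: "comb x r b = 0" if "r < n - k" for r
      using that by (simp add: comb_def mult.commute)
    \<comment> \<open>A kernel vector of the boundary matrix yields a solution in X_k, and so does
      its negative; \<open>neg\<close> applied to both makes it vanish. The sum over a singleton
      lets the lemmas on sums handle the scalar -1.\<close>
    define minus where "minus j t = (\<Sum>i\<in>{()}. - 1 * comb x j t)" for j t
    have minus: "derivative_chain {a..b} n minus" "chain_op n d minus t = - chain_op n d (comb x) t" for t
      using derivative_chain_sum[of "{()}" "{a..b}" n "\<lambda>_. comb x" "\<lambda>_. -1"]
        chain_op_sum[of n d "\<lambda>_. -1" "\<lambda>_. comb x" "{()}" t] comb(1)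
      by (simp_all add: minus_def[abs_def])
    have zero: "comb x 0 t = 0" if t: "t \<in> {a..b}" for t
    proof -
      have "(-1) ^ (n - k) * comb x 0 t \<le> 0"
        by (rule neg[OF comb(1)]) (use t b0 comb comb_a in auto)
      moreover have "(-1) ^ (n - k) * minus 0 t \<le> 0"
        by (rule neg[OF minus(1)]) (use t b0 minus comb comb_a in \<open>auto simp: minus_def\<close>)
      ultimately show ?thesis
        by (cases "even (n - k)") (auto simp: minus_def)
    qed
    show "\<forall>j<n - k. x j = 0"
    proof (intro allI impI)
      fix j assume j: "j < n - k"
      have "derivative_chain {a..b} n (\<lambda>_ _. 0)" by (simp add: derivative_chain_def)
      then have "nderiv_within {a..b} (k + j) (comb x 0) a = 0"
        using nderiv_within_chain[OF \<open>a < b\<close>, of n "\<lambda>_ _. 0" "comb x 0" "k + j" a] zero j \<open>a < b\<close> by simp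
      moreover have "nderiv_within {a..b} (k + j) (comb x 0) a = comb x (k + j) a"
        using nderiv_within_chain[OF \<open>a < b\<close> comb(1) refl, of "k + j" a] j \<open>a < b\<close> by simp
      ultimately show "x j = 0" using comb_a'[OF j] by simp
    qed
  qed
  have "\<forall>i. \<exists>x. \<forall>r<n - k. (\<Sum>l<n - k. \<phi> (k + l) r b * x l) = - \<phi> i r b"
    by (intro allI solvable)
  from choice[OF this] obtain X where
    X: "\<And>i r. r < n - k \<Longrightarrow> (\<Sum>l<n - k. \<phi> (k + l) r b * X i l) = - \<phi> i r b" by blast
  \<comment> \<open>The correction cancels the derivatives of \<open>\<phi> i\<close> at
    \<open>b\<close> up to order n - k - 1 and leaves those of order below k at \<open>a\<close>
    unchanged.\<close>
  define w where "w i j t = \<phi> i j t + comb (X i) j t" for i j t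
  have w: "derivative_chain {a..b} n (w i)" "\<And>t. t \<in> {a..b} \<Longrightarrow> chain_op n d (w i) t = 0" for i
    using derivative_chain_add[OF \<phi>(1)[of i] comb(1)[of "X i"]]
      chain_op_add[of n d "\<phi> i" "comb (X i)"] \<phi>(2) comb(2)
    by (simp_all add: w_def[abs_def])
  have w_a: "w i j a = (if i = j then 1 else 0)" if "j < k" for i j
    using that comb_a \<open>k \<le> n\<close> by (simp add: w_def \<phi>)
  have w_b: "w i r b = 0" if "r < n - k" for i r
    using X[OF that, of i] by (simp add: w_def comb_def mult.commute)

  \<comment> \<open>The derivative of order k - 1 equals 1 at \<open>a\<close>, hence is positive
    nearby, and the lower ones vanish at \<open>a\<close>.\<close>
  obtain t0 where t0: "a < t0" "t0 \<le> b" "w (k - 1) 0 t0 > 0"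
  proof -
    have "continuous_on {a..b} (w (k - 1) (k - 1))"
      using derivative_chain_continuous[OF w(1)] \<open>k \<le> n\<close> by simp
    moreover have "w (k - 1) (k - 1) a = 1" using w_a \<open>1 \<le> k\<close> by simp
    ultimately obtain \<delta> where \<delta>: "\<delta> > 0"
      "\<And>t. t \<in> {a..b} \<Longrightarrow> \<bar>t - a\<bar> < \<delta> \<Longrightarrow> \<bar>w (k - 1) (k - 1) t - 1\<bar> < 1"
      using \<open>a < b\<close> unfolding continuous_on_iff dist_real_def
      by (metis atLeastAtMost_iff less_eq_real_def zero_less_one)
    define c where "c = min b (a + \<delta> / 2)"
    have c: "a < c" "c \<le> b" "c < a + \<delta>" using \<open>a < b\<close> \<delta>(1) by (auto simp: c_def)
    have "derivative_chain {a..b} (k - 1) (w (k - 1))"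
      using w(1)[of "k - 1"] derivative_chain_continuous[OF w(1)] \<open>k \<le> n\<close> by (auto simp: derivative_chain_def)
    then have "w (k - 1) 0 c > 0"
    proof (rule derivative_chain_pos[OF _ c(2)])
      fix t assume "a < t" "t \<le> c"
      then show "w (k - 1) (k - 1) t > 0" using \<delta>(2)[of t] c by force
    qed (use c w_a in auto)
    then show thesis using that c by blast
  qed

  have "\<exists>D. \<forall>t\<in>{a..b}. \<bar>d j t\<bar> \<le> D" if "j \<in> {1..n}" for j
    using compact_imp_bounded[OF compact_continuous_image[OF d[OF that] compact_Icc]]
    by (auto simp: bounded_iff)
  then obtain D0 where D0: "\<And>j t. j \<in> {1..n} \<Longrightarrow> t \<in> {a..b} \<Longrightarrow> \<bar>d j t\<bar> \<le> D0 j" by metis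
  define D where "D = (\<Sum>j=1..n. \<bar>D0 j\<bar>)"
  have Dpos: "D \<ge> 0" by (auto simp: D_def intro: sum_nonneg)
  have D: "\<bar>d j t\<bar> \<le> D" if "j \<in> {1..n}" "t \<in> {a..b}" for j t
    using D0[OF that] member_le_sum[of j "{1..n}" "\<lambda>j. \<bar>D0 j\<bar>"] that by (simp add: D_def)

  define q :: "nat \<Rightarrow> real" where "q i = fact (n + 1) / fact (n + 1 - i)" for i :: nat
  \<comment> \<open>Up to the positive factor \<open>e ^ (n + 2 - k)\<close>, this is (-1)^(n-k)
    u(t0) for the test function u below: a polynomial in \<open>e\<close> whose constant term comes
    from i = k - 1.\<close>
  define h where "h e = (\<Sum>i<k. (-1) ^ (k - 1 - i) * q i * w i 0 t0 * e ^ (k - 1 - i))" for e :: real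
  \<comment> \<open>The second bound puts \<open>t0\<close> outside the support of the cutoff; the
    third gives both e \<le> 1 and n D e \<le> 1.\<close>
  have h: "h e \<le> 0" if e: "0 < e" "e \<le> t0 - a" "e \<le> 1 / (real n * D + 1)" for e
  proof -
    define P where "P = cutoff_chain n (a + e)"
    have "real n * D + 1 > 0" using Dpos by (simp add: add_nonneg_pos)
    then have e1: "e * (real n * D + 1) \<le> 1" using e(3) by (simp add: pos_le_divide_eq)
    have "e * (real n * D) \<ge> 0" using e Dpos by simp
    then have e2: "e \<le> 1" "real n * D * e \<le> 1" using e1 e(1) by (auto simp: algebra_simps)
    define u where "u j t = P j t + (\<Sum>i<k. - P i a * w i j t)" for j t
    have "derivative_chain {a..b} n u"
      unfolding u_def[abs_def] P_def
      by (intro derivative_chain_add cutoff_chain derivative_chain_sum w)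
    moreover have "u j a = 0" if "j < k" for j
      using that w_a by (simp add: u_def if_distrib[of "\<lambda>r. _ * r"] sum.delta' cong: if_cong)
    moreover have "u j b = 0" if "j < n - k" for j
      using that e t0 w_b by (simp add: u_def P_def cutoff_chain_eq_0)
    moreover have "chain_op n d u t \<ge> 0" if t: "t \<in> {a..b}" for t
    proof -
      have "chain_op n d P t \<ge> 0"
        unfolding P_def by (rule chain_op_cutoff_nonneg[where D = D, OF D e2 t])
      then show ?thesis
        unfolding u_def[abs_def] chain_op_add chain_op_sum using t w by simp
    qed
    ultimately have "(-1) ^ (n - k) * u 0 t0 \<le> 0"
      using t0 by (intro neg) auto
    also have "u 0 t0 = (\<Sum>i<k. - P i a * w i 0 t0)"
      using e by (simp add: u_def P_def cutoff_chain_eq_0)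
    \<comment> \<open>The i-th derivative of P at \<open>a\<close> has size
      \<open>q i * e ^ (n + 1 - i)\<close>; the lowest exponent, n + 2 - k at i = k - 1, is factored
      out.\<close>
    also have "(-1) ^ (n - k) * \<dots> = e ^ (n + 2 - k) * h e"
      unfolding h_def sum_distrib_left
    proof (intro sum.cong refl)
      fix i assume "i \<in> {..<k}"
      then have i: "i < k" by simp
      have exps: "n + 1 - i = (n + 2 - k) + (k - 1 - i)" using i \<open>k \<le> n\<close> by simp
      have "(n - k) + (n + i) + 1 = 2 * (n - k + i + 1) + (k - 1 - i)"
        using i \<open>k \<le> n\<close> by simp
      then have "(-1::real) ^ ((n - k) + (n + i) + 1) = (-1) ^ (2 * (n - k + i + 1)) * (-1) ^ (k - 1 - i)"
        by (simp only: power_add)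
      then have sign: "(-1::real) ^ (n - k) * ((-1) ^ (n + i) * (-1)) = (-1) ^ (k - 1 - i)"
        by (simp add: power_add)
      have "P i a = (-1) ^ (n + i) * q i * (e ^ (n + 2 - k) * e ^ (k - 1 - i))"
        using e(1) unfolding power_add[symmetric] exps[symmetric]
        by (simp add: P_def cutoff_chain_def q_def)
      then have "(-1) ^ (n - k) * (- P i a * w i 0 t0) =
          ((-1) ^ (n - k) * ((-1) ^ (n + i) * (-1))) * (q i * (e ^ (n + 2 - k) * e ^ (k - 1 - i)) * w i 0 t0)"
        by (simp only: mult_ac mult_minus_left mult_minus_right mult_1_right)
      then show "(-1) ^ (n - k) * (- P i a * w i 0 t0) =
          e ^ (n + 2 - k) * ((-1) ^ (k - 1 - i) * q i * w i 0 t0 * e ^ (k - 1 - i))"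
        unfolding sign by (simp only: mult_ac)
    qed
    finally show ?thesis using zero_less_power[OF e(1), of "n + 2 - k"]
      by (metis mult_le_0_iff not_le)
  qed
  have "(h \<longlongrightarrow> h 0) (at_right 0)"
    unfolding h_def by (intro tendsto_intros)
  moreover have "\<forall>\<^sub>F e in at_right 0. h e \<le> 0"
    unfolding eventually_at_right_field
  proof (intro exI conjI allI impI)
    have "real n * D \<ge> 0" using Dpos by simp
    then show "0 < min (t0 - a) (1 / (real n * D + 1))" using t0 by simp
  qed (intro h, auto)
  ultimately have "h 0 \<le> 0" by (intro tendsto_upperbound) auto
  \<comment> \<open>At e = 0 only the summand with exponent 0 survives, as 0^0 = 1; its sign factor
    is (-1)^0.\<close>
  moreover have "h 0 = q (k - 1) * w (k - 1) 0 t0"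
  proof -
    obtain m where "k = Suc m" using \<open>1 \<le> k\<close> by (cases k) auto
    then show ?thesis by (simp add: h_def power_0_left)
  qed
  moreover have "q (k - 1) > 0" by (simp add: q_def)
  ultimately show False using t0(3) by (simp add: mult_le_0_iff)
qed

section \<open>Transfer from derivative chains to T_n[M] on X_k\<close>

theorem corollary3p6:
  fixes n k :: nat and a b :: real and c :: "nat \<Rightarrow> real \<Rightarrow> real"
  assumes "1 \<le> k" and "k + 2 \<le> n"
    and "a < b"
    and "\<And>j. 1 \<le> j \<Longrightarrow> j \<le> n \<Longrightarrow> c j \<in> Cn_on (n - j) {a..b}"
  shows "(even (n - k) \<longrightarrow>
            \<not> (\<exists>M::real. inverse_negative_on {a..b} (linear_op a b n c M) (X_space a b n k)))
       \<and> (odd (n - k) \<longrightarrow>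
            \<not> (\<exists>M::real. inverse_positive_on {a..b} (linear_op a b n c M) (X_space a b n k)))"
proof -
  have False
    if neg: "\<And>u t. u \<in> X_space a b n k \<Longrightarrow> \<forall>t\<in>{a..b}. linear_op a b n c M u t \<ge> 0 \<Longrightarrow>
      t \<in> {a..b} \<Longrightarrow> (-1) ^ (n - k) * u t \<le> 0" for M
  proof -
    define d where "d j t = c j t + (if j = n then M else 0)" for j t
    show False
    proof (rule no_sign_preservation[OF \<open>a < b\<close> \<open>1 \<le> k\<close>])
      show "k \<le> n" using assms by simp
      show "continuous_on {a..b} (d j)" if j: "j \<in> {1..n}" for j
      proof -
        have "c j \<in> Cn_on (n - j) {a..b}" using assms(4) j by simp
        \<comment> \<open>For j = n this is the continuity clause of \<open>Cn_on\<close>; for j < n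
          it comes from differentiability.\<close>
        then have "continuous_on {a..b} (c j)"
          by (cases "n - j") (force simp: Cn_on_def intro: differentiable_imp_continuous_on)+
        then show ?thesis unfolding d_def by (intro continuous_intros) auto
      qed
      fix F t
      assume F: "derivative_chain {a..b} n F" "\<And>j. j < k \<Longrightarrow> F j a = 0" "\<And>j. j < n - k \<Longrightarrow> F j b = 0"
        and pos: "\<And>t. t \<in> {a..b} \<Longrightarrow> chain_op n d F t \<ge> 0" and t: "t \<in> {a..b}"
      have eq: "nderiv_within {a..b} j (F 0) s = F j s" if "j \<le> n" "s \<in> {a..b}" for j s
        by (rule nderiv_within_chain[OF \<open>a < b\<close> F(1) refl that])
      have "F 0 \<in> X_space a b n k"
        using derivative_chain_Cn_on[OF \<open>a < b\<close> F(1)] F(2,3) \<open>a < b\<close> assms(2)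
        by (auto simp: X_space_def eq)
      moreover have "linear_op a b n c M (F 0) s = chain_op n d F s" if s: "s \<in> {a..b}" for s
      proof -
        \<comment> \<open>This splits off the summand j = n of \<open>chain_op\<close>, which
          \<open>linear_op\<close> lists separately and which alone contains
          \<open>M\<close>.\<close>
        obtain m where m: "n = Suc m" using assms by (cases n) auto
        have "(\<Sum>j = 1..m. c j s * nderiv_within {a..b} (n - j) (F 0) s) = (\<Sum>j = 1..m. d j s * F (n - j) s)"
          using s by (intro sum.cong) (auto simp: eq d_def m)
        then show ?thesis using s by (simp add: linear_op_def chain_op_def eq m d_def del: nderiv_within.simps)
      qed
      ultimately show "(-1) ^ (n - k) * F 0 t \<le> 0" using pos t by (intro neg) auto
    qed
  qed
  note contra = this
  show ?thesis
  proof (intro conjI impI notI; elim exE)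
    fix M assume "even (n - k)" "inverse_negative_on {a..b} (linear_op a b n c M) (X_space a b n k)"
    then show False by (intro contra[of M]) (auto simp: inverse_negative_on_def)
  next
    fix M assume "odd (n - k)" "inverse_positive_on {a..b} (linear_op a b n c M) (X_space a b n k)"
    then show False by (intro contra[of M]) (auto simp: inverse_positive_on_def)
  qed
qed

end
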